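(* Let $m,n$ be positive integers and let $A,B,C\in \mathbb{M}_m(\mathbb{M}_n)$ be positive semidefinite. Then \[ \mathrm{per}_1(A+B+C)+\mathrm{per}_1A+\mathrm{per}_1B+\mathrm{per}_1C\;\ge\;\mathrm{per}_1(A+B)+\mathrm{per}_1(A+C)+\mathrm{per}_1(B+C), \] and \[ \mathrm{per}_2(A+B+C)+\mathrm{per}_2A+\mathrm{per}_2B+\mathrm{per}_2C\;\ge\;\mathrm{per}_2(A+B)+\mathrm{per}_2(A+C)+\mathrm{per}_2(B+C). \]
   Context: $\mathbb{M}_k$ is the space of $k\times k$ complex matrices, and $\mathbb{M}_m(\mathbb{M}_n)$ is the set of $m\times m$ block matrices $A=[A_{ij}]_{i,j=1}^m$ with blocks $A_{ij}\in\mathbb{M}_n$ (positive semidefiniteness refers to $A$ viewed as an $mn\times mn$ complex Hermitian matrix). For Hermitian matrices $X,Y$ of the same size, $X\ge Y$ means that $X-Y$ is positive semidefinite. The permanent of $X=(x_{ij})\in\mathbb{M}_k$ is $\mathrm{per}\,X=\sum_{\sigma\in S_k}\prod_{i=1}^k x_{i\sigma(i)}$. Partial permanents: let $A=[A_{ij}]_{i,j=1}^m\in\mathbb{M}_m(\mathbb{M}_n)$ with $A_{ij}=[a_{rs}^{ij}]_{r,s=1}^n$. Then $\mathrm{per}_2A=[\mathrm{per}\,A_{ij}]_{i,j=1}^m\in\mathbb{M}_m$. Putting $B_{rs}=[a_{rs}^{ij}]_{i,j=1}^m\in\mathbb{M}_m$ for $1\le r,s\le n$, $\mathrm{per}_1A=[\mathrm{per}\,B_{rs}]_{r,s=1}^n\in\mathbb{M}_n$.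 *)

theory Defs
  imports "HOL-Analysis.Analysis"
begin

definition permanent :: "'a::comm_ring_1^'k^'k \<Rightarrow> 'a" where
  "permanent X = (\<Sum>\<sigma> | \<sigma> permutes (UNIV :: 'k set). \<Prod>i\<in>UNIV. X $ i $ \<sigma> i)"

definition hermitian :: "complex^'k^'k \<Rightarrow> bool" where
  "hermitian X \<longleftrightarrow> (\<forall>i j. X $ j $ i = cnj (X $ i $ j))"

text \<open>For Hermitian \<open>X\<close> the form \<open>v\<^sup>* X v\<close> is real, so taking its real part loses nothing.\<close>

definition psd :: "complex^'k^'k \<Rightarrow> bool" where
  "psd X \<longleftrightarrow> hermitian X \<and>
     (\<forall>v :: complex^'k. 0 \<le> Re (\<Sum>i\<in>UNIV. cnj (v $ i) * (X *v v) $ i))"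

definition loewner_le :: "complex^'k^'k \<Rightarrow> complex^'k^'k \<Rightarrow> bool" (infix \<open>\<le>\<^sub>L\<close> 50) where
  "X \<le>\<^sub>L Y \<longleftrightarrow> hermitian X \<and> hermitian Y \<and> psd (Y - X)"

text \<open>
  A block matrix in \<open>M_m(M_n)\<close>, with \<open>m = CARD('m)\<close> and \<open>n = CARD('n)\<close>, has the block
  \<open>A_ij = A $ i $ j\<close> and the entries \<open>a_rs^ij = A $ i $ j $ r $ s\<close>.
  The pair \<open>(i, r)\<close> indexes the rows of the corresponding \<open>mn \<times> mn\<close> matrix.
\<close>

type_synonym ('n, 'm) block_matrix = "complex^'n^'n^'m^'m"

definition flatten :: "('n::finite, 'm::finite) block_matrix \<Rightarrow> complex^('m \<times> 'n)^('m \<times> 'n)" where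
  "flatten A = (\<chi> p q. A $ fst p $ fst q $ snd p $ snd q)"

definition per\<^sub>1 :: "('n::finite, 'm::finite) block_matrix \<Rightarrow> complex^'n^'n" where
  "per\<^sub>1 A = (\<chi> r s. permanent (\<chi> i j. A $ i $ j $ r $ s))"

definition per\<^sub>2 :: "('n::finite, 'm::finite) block_matrix \<Rightarrow> complex^'m^'m" where
  "per\<^sub>2 A = (\<chi> i j. permanent (A $ i $ j))"

end

theory Submission
  imports Defs
begin

text \<open>
  Summing over pairs of permutations,
  \<open>n! per A\<^sub>i\<^sub>j = \<Sum>\<^sub>\<pi> \<Sum>\<^sub>\<sigma> \<Prod>\<^sub>r A((i, \<pi> r), (j, \<sigma> r))\<close>, so \<open>per\<^sub>2 A\<close> is a compression of a
  Hadamard product of pullbacks of \<open>A\<close>. Writing positive semidefinite kernels as sums of kernels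
  \<open>cnj (f x) f y\<close> makes it evident that they are closed under Hadamard products (Schur), and
  expanding \<open>\<Prod>(A + B + C) + \<Prod>A + \<Prod>B + \<Prod>C - \<Prod>(A + B) - \<Prod>(A + C) - \<Prod>(B + C)\<close> leaves
  only products with nonnegative coefficients. Exchanging the roles of the two index pairs
  turns \<open>per\<^sub>1\<close> into \<open>per\<^sub>2\<close>.
\<close>

section \<open>Gram kernels and their closure properties\<close>

inductive gram :: "('x \<Rightarrow> 'x \<Rightarrow> complex) \<Rightarrow> bool" where
  gram_zero: "gram (\<lambda>x y. 0)"
| gram_rank_one_add: "gram K \<Longrightarrow> gram (\<lambda>x y. K x y + cnj (f x) * f y)"

lemma gram_add:
  assumes "gram K" "gram L"
  shows "gram (\<lambda>x y. K x y + L x y)"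
  using assms(2)
proof induction
  case gram_zero
  then show ?case using assms(1) by simp
next
  case (gram_rank_one_add L f)
  from gram.gram_rank_one_add[OF gram_rank_one_add.IH, of f] show ?case
    by (simp add: add.assoc)
qed

lemma gram_rank_one: "gram (\<lambda>x y. cnj (f x) * f y)"
  using gram_rank_one_add[OF gram_zero, of f] by simp

lemma gram_const:
  assumes "0 \<le> c"
  shows "gram (\<lambda>x y. complex_of_real c)"
  using gram_rank_one[of "\<lambda>_. complex_of_real (sqrt c)"] assms
  by (simp flip: of_real_mult)

text \<open>The rank-one kernels of \<open>g\<close> and \<open>f\<close> multiply to the rank-one
  kernel of \<open>g x * f x\<close>; the Schur product theorem then needs only
  distributivity.\<close>

lemma gram_mult_rank_one:
  assumes "gram K"
  shows "gram (\<lambda>x y. K x y * (cnj (f x) * f y))"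
  using assms
proof induction
  case gram_zero
  then show ?case using gram.gram_zero by simp
next
  case (gram_rank_one_add K g)
  from gram.gram_rank_one_add[OF gram_rank_one_add.IH, of "\<lambda>x. g x * f x"] show ?case
    by (simp add: algebra_simps)
qed

lemma gram_mult:
  assumes "gram K" "gram L"
  shows "gram (\<lambda>x y. K x y * L x y)"
  using assms(2)
proof induction
  case gram_zero
  then show ?case using gram.gram_zero by simp
next
  case (gram_rank_one_add L f)
  from gram_add[OF gram_rank_one_add.IH gram_mult_rank_one[OF assms(1), of f]] show ?case
    by (simp add: algebra_simps)
qed

lemma gram_pullback:
  assumes "gram K"
  shows "gram (\<lambda>x y. K (h x) (h y))"
  using assms
proof induction
  case gram_zero
  then show ?case using gram.gram_zero by simp
next
  case (gram_rank_one_add K f)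
  from gram.gram_rank_one_add[OF gram_rank_one_add.IH, of "\<lambda>x. f (h x)"] show ?case .
qed

text \<open>On a rank-one kernel the double sum factors, leaving the rank-one kernel of the summed
  function. Using the same \<open>P\<close> for both arguments is what makes the two factors
  conjugate.\<close>

lemma gram_compress:
  assumes "gram K"
  shows "gram (\<lambda>i j. \<Sum>p\<in>P. \<Sum>q\<in>P. K (i, p) (j, q))"
  using assms
proof induction
  case gram_zero
  then show ?case using gram.gram_zero by simp
next
  case (gram_rank_one_add K f)
  from gram.gram_rank_one_add[OF gram_rank_one_add.IH, of "\<lambda>i. \<Sum>p\<in>P. f (i, p)"] show ?case
    by (simp add: sum.distrib sum_product)
qed

lemma gram_hermitian:
  assumes "gram K"
  shows "K y x = cnj (K x y)"
  using assms by induction simp_all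

text \<open>Each rank-one summand contributes the squared modulus of the sum of
  \<open>v x * f x\<close>.\<close>

lemma gram_form_nonneg:
  assumes "gram K"
  shows "0 \<le> Re (\<Sum>x\<in>S. \<Sum>y\<in>S. cnj (v x) * K x y * v y)"
  using assms
proof induction
  case gram_zero
  then show ?case by simp
next
  case (gram_rank_one_add K f)
  have "(\<Sum>x\<in>S. \<Sum>y\<in>S. cnj (v x) * (cnj (f x) * f y) * v y)
      = cnj (\<Sum>x\<in>S. v x * f x) * (\<Sum>y\<in>S. v y * f y)"
    unfolding cnj_sum sum_product by (simp add: mult_ac)
  moreover have "0 \<le> Re (cnj z * z)" for z
    by simp
  ultimately have "0 \<le> Re (\<Sum>x\<in>S. \<Sum>y\<in>S. cnj (v x) * (cnj (f x) * f y) * v y)"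
    by (simp only:)
  then show ?case
    using gram_rank_one_add.IH by (simp add: algebra_simps sum.distrib)
qed

section \<open>Gram kernels and positive semidefinite matrices\<close>

lemma psd_if_gram:
  assumes "gram (\<lambda>i j. X $ i $ j)"
  shows "psd X"
proof -
  have "(\<Sum>i\<in>UNIV. cnj (v $ i) * (X *v v) $ i)
      = (\<Sum>i\<in>UNIV. \<Sum>j\<in>UNIV. cnj (v $ i) * X $ i $ j * v $ j)" for v
    by (simp add: matrix_vector_mult_def sum_distrib_left mult.assoc)
  then have "0 \<le> Re (\<Sum>i\<in>UNIV. cnj (v $ i) * (X *v v) $ i)" for v
    using gram_form_nonneg[OF assms, where S = UNIV and v = "\<lambda>i. v $ i"] by simp
  moreover have "hermitian X"
    unfolding hermitian_def using gram_hermitian[OF assms] by blast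
  ultimately show ?thesis
    by (simp add: psd_def)
qed

text \<open>Cholesky elimination, one index at a time: subtracting \<open>K x a * K a y / K a a\<close> clears row
  and column \<open>a\<close>.\<close>

lemma gram_if_form_nonneg:
  fixes K :: "'x::finite \<Rightarrow> 'x \<Rightarrow> complex"
  assumes "finite F"
    and "\<And>x y. K y x = cnj (K x y)"
    and "\<And>v. 0 \<le> Re (\<Sum>x\<in>UNIV. \<Sum>y\<in>UNIV. cnj (v x) * K x y * v y)"
    and "\<And>x y. x \<notin> F \<Longrightarrow> K x y = 0"
  shows "gram K"
  using assms
proof (induction F arbitrary: K)
  case empty
  then have "K = (\<lambda>x y. 0)" by auto
  then show ?case using gram_zero by simp
next
  case (insert a F)
  note herm = insert.prems(1) and nonneg = insert.prems(2) and supp = insert.prems(3)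
  define Q where "Q v = (\<Sum>x\<in>UNIV. \<Sum>y\<in>UNIV. cnj (v x) * K x y * v y)" for v
  define R where "R v = (\<Sum>y\<in>UNIV. K a y * v y)" for v
  \<comment> \<open>The effect on the form of moving \<open>v\<close> by \<open>t\<close> along
    coordinate \<open>a\<close>. Both cases below rest on a suitable choice of
    \<open>t\<close>.\<close>
  have shift: "Q (\<lambda>x. v x + (if x = a then t else 0))
      = Q v + cnj t * R v + t * cnj (R v) + cnj t * t * K a a" for v t
  proof -
    have "cnj (v x + (if x = a then t else 0)) * K x y * (v y + (if y = a then t else 0))
      = cnj (v x) * K x y * v y + (if x = a then cnj t * (K a y * v y) else 0)
        + (if y = a then t * (cnj (v x) * K x a) else 0)
        + (if x = a then if y = a then cnj t * t * K a a else 0 else 0)" for x y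
      by (auto simp: algebra_simps)
    moreover have "(\<Sum>x\<in>UNIV. cnj (v x) * K x a) = cnj (R v)"
      unfolding R_def by (simp add: herm[of a] mult.commute)
    moreover have "(\<Sum>x\<in>UNIV. \<Sum>y\<in>UNIV. if x = a then h y else 0) = (\<Sum>y\<in>UNIV. h y)"
      for h :: "'x \<Rightarrow> complex"
      by (subst sum.swap) simp
    moreover have "(\<Sum>x\<in>UNIV. \<Sum>y\<in>UNIV. if x = a then if y = a then c else 0 else 0) = c"
      for c :: complex
      by (subst sum.swap) simp
    ultimately show ?thesis
      by (simp add: Q_def sum.distrib R_def flip: sum_distrib_left)
  qed
  have Kaa: "K a a = complex_of_real (Re (K a a))"
    using herm[of a a] by (metis Reals_cnj_iff of_real_Re)
  have "Q (\<lambda>x. if x = a then 1 else 0) = K a a"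
    using shift[of "\<lambda>_. 0" 1] by (simp add: Q_def R_def)
  then have Kaa_nonneg: "0 \<le> Re (K a a)"
    using nonneg[of "\<lambda>x. if x = a then 1 else 0"] by (simp add: Q_def)
  show ?case
  proof (cases "K a a = 0")
    case True
    \<comment> \<open>A zero pivot forces its row to vanish: the form is then affine in
      \<open>s\<close> along the chosen direction, so a nonzero entry would drive it below
      zero.\<close>
    have row: "K a b = 0" for b
    proof (rule ccontr)
      assume "K a b \<noteq> 0"
      define e where "e = (\<lambda>x. if x = b then 1 else 0 :: complex)"
      define N where "N = (cmod (K a b))\<^sup>2"
      \<comment> \<open>Large enough that \<open>2 * s * N\<close> exceeds \<open>Re (Q e)\<close>,
        whatever its sign.\<close>
      define s where "s = (\<bar>Re (Q e)\<bar> + 1) / N"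
      have "N > 0" using \<open>K a b \<noteq> 0\<close> by (simp add: N_def)
      have "R e = K a b" by (simp add: R_def e_def if_distrib cong: if_cong)
      \<comment> \<open>With this phase both cross terms equal \<open>- s * N\<close>; the term
        quadratic in \<open>t\<close> drops out because \<open>K a a = 0\<close>.\<close>
      define t where "t = - complex_of_real s * K a b"
      have "cnj t * R e + t * cnj (R e) = complex_of_real (- 2 * s * N)"
        using \<open>R e = K a b\<close> complex_norm_square[of "K a b"]
        by (simp add: t_def N_def algebra_simps)
      then have "Re (Q (\<lambda>x. e x + (if x = a then t else 0))) = Re (Q e) - 2 * s * N"
        unfolding shift using True by (simp add: add.assoc)
      also have "s * N = \<bar>Re (Q e)\<bar> + 1"
        using \<open>N > 0\<close> by (simp add: s_def)
      then have "Re (Q e) - 2 * s * N < 0" by linarith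
      finally show False
        using nonneg[of "\<lambda>x. e x + (if x = a then t else 0)"] by (simp add: Q_def)
    qed
    show ?thesis
    proof (rule insert.IH)
      show "K y x = cnj (K x y)" for x y by (rule herm)
      show "0 \<le> Re (\<Sum>x\<in>UNIV. \<Sum>y\<in>UNIV. cnj (v x) * K x y * v y)" for v by (rule nonneg)
      show "K x y = 0" if "x \<notin> F" for x y
        using that row supp by (cases "x = a") auto
    qed
  next
    case False
    define d where "d = Re (K a a)"
    have d1: "K a a = complex_of_real d"
      unfolding d_def by (rule Kaa)
    moreover have "d > 0"
      using False Kaa_nonneg d1 by (auto simp: less_le simp flip: d_def)
    ultimately have d: "K a a = complex_of_real d" "d > 0" .
    define f where "f y = K a y / complex_of_real (sqrt d)" for y
    have ff: "cnj (f x) * f y = cnj (K a x) * K a y / complex_of_real d" for x y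
      using d by (simp add: f_def flip: of_real_mult)
    define K' where "K' x y = K x y - cnj (f x) * f y" for x y
    have "gram K'"
    proof (rule insert.IH)
      show "K' y x = cnj (K' x y)" for x y
        using herm[of y x] by (simp add: K'_def)
      show "K' x y = 0" if "x \<notin> F" for x y
      proof (cases "x = a")
        case True
        then show ?thesis using d by (simp add: K'_def ff)
      next
        case False
        then have "x \<notin> insert a F" using that by simp
        then have "K x y = 0" "K a x = 0"
          using supp herm[of a x] by auto
        then show ?thesis by (simp add: K'_def ff)
      qed
      show "0 \<le> Re (\<Sum>x\<in>UNIV. \<Sum>y\<in>UNIV. cnj (v x) * K' x y * v y)" for v
      proof -
        \<comment> \<open>This \<open>t\<close> minimises the form in coordinate \<open>a\<close>.
          Completing the square, the minimum is the form of the Schur complement \<open>K'\<close>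
          at \<open>v\<close>, so \<open>K'\<close> inherits nonnegativity.\<close>
        define t where "t = - R v / complex_of_real d"
        have "(\<Sum>x\<in>UNIV. \<Sum>y\<in>UNIV. cnj (v x) * (cnj (f x) * f y) * v y)
            = cnj (R v) * R v / complex_of_real d"
          unfolding R_def ff cnj_sum sum_product by (simp add: sum_divide_distrib mult_ac)
        then have "(\<Sum>x\<in>UNIV. \<Sum>y\<in>UNIV. cnj (v x) * K' x y * v y)
            = Q v - cnj (R v) * R v / complex_of_real d"
          by (simp add: K'_def Q_def left_diff_distrib right_diff_distrib sum_subtractf)
        also have "\<dots> = Q (\<lambda>x. v x + (if x = a then t else 0))"
          unfolding shift d(1) using d(2) by (simp add: t_def field_simps)
        finally show ?thesis
          using nonneg[of "\<lambda>x. v x + (if x = a then t else 0)"] by (simp add: Q_def)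
      qed
    qed
    from gram_rank_one_add[OF this, of f] show ?thesis
      by (simp add: K'_def)
  qed
qed

lemma gram_if_psd:
  assumes "psd X"
  shows "gram (\<lambda>i j. X $ i $ j)"
proof (rule gram_if_form_nonneg[OF finite])
  show "X $ j $ i = cnj (X $ i $ j)" for i j
    using assms unfolding psd_def hermitian_def by blast
  show "0 \<le> Re (\<Sum>i\<in>UNIV. \<Sum>j\<in>UNIV. cnj (v i) * X $ i $ j * v j)" for v
  proof -
    have "0 \<le> Re (\<Sum>i\<in>UNIV. cnj ((\<chi> i. v i) $ i) * (X *v (\<chi> i. v i)) $ i)"
      using assms unfolding psd_def by blast
    then show ?thesis
      by (simp add: matrix_vector_mult_def sum_distrib_left mult.assoc)
  qed
qed auto

section \<open>Finite differences of products of Gram kernels\<close>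

lemma gram_prod:
  assumes "finite S" "\<And>r. gram (A r)"
  shows "gram (\<lambda>x y. \<Prod>r\<in>S. A r x y)"
  using assms(1)
proof induction
  case empty
  then show ?case using gram_const[of 1] by simp
next
  case (insert r S)
  then show ?case using gram_mult[OF assms(2) insert.IH, of r] by simp
qed

text \<open>Splitting off the factor \<open>r\<close> leaves \<open>A r\<close> times the smaller
  difference plus \<open>B r\<close> times the product of the sums.\<close>

lemma gram_prod_diff1:
  assumes "finite S" "\<And>r. gram (A r)" "\<And>r. gram (B r)"
  shows "gram (\<lambda>x y. (\<Prod>r\<in>S. A r x y + B r x y) - (\<Prod>r\<in>S. A r x y))"
  using assms(1)
proof induction
  case empty
  then show ?case using gram_zero by simp
next
  case (insert r S)
  have "gram (\<lambda>x y. \<Prod>r\<in>S. A r x y + B r x y)"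
    using insert.hyps(1) by (intro gram_prod gram_add assms)
  from gram_add[OF gram_mult[OF assms(2)[of r] insert.IH] gram_mult[OF assms(3)[of r] this]]
  show ?case using insert.hyps by (simp add: algebra_simps)
qed

text \<open>Splitting off the factor \<open>r\<close>, the coefficient of \<open>A r\<close> is the
  same expression over \<open>S\<close>, while those of \<open>B r\<close> and \<open>C r\<close>
  are first-order differences.\<close>

lemma gram_prod_diff2:
  assumes "finite S" "\<And>r. gram (A r)" "\<And>r. gram (B r)" "\<And>r. gram (C r)"
  shows "gram (\<lambda>x y. (\<Prod>r\<in>S. A r x y + B r x y + C r x y) + (\<Prod>r\<in>S. A r x y)
    - (\<Prod>r\<in>S. A r x y + B r x y) - (\<Prod>r\<in>S. A r x y + C r x y))"
  using assms(1)
proof induction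
  case empty
  then show ?case using gram_zero by simp
next
  case (insert r S)
  have B: "gram (\<lambda>x y. (\<Prod>r\<in>S. A r x y + B r x y + C r x y) - (\<Prod>r\<in>S. A r x y + B r x y))"
    using insert.hyps(1) by (intro gram_prod_diff1 gram_add assms)
  have "gram (\<lambda>x y. (\<Prod>r\<in>S. A r x y + C r x y + B r x y) - (\<Prod>r\<in>S. A r x y + C r x y))"
    using insert.hyps(1) by (intro gram_prod_diff1 gram_add assms)
  then have C: "gram (\<lambda>x y. (\<Prod>r\<in>S. A r x y + B r x y + C r x y) - (\<Prod>r\<in>S. A r x y + C r x y))"
    by (simp add: add_ac)
  from gram_add[OF gram_add[OF gram_mult[OF assms(2)[of r] insert.IH]
        gram_mult[OF assms(3)[of r] B]] gram_mult[OF assms(4)[of r] C]]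
  show ?case using insert.hyps by (simp add: algebra_simps)
qed

lemma gram_prod_diff3:
  assumes "finite S" "\<And>r. gram (A r)" "\<And>r. gram (B r)" "\<And>r. gram (C r)"
  shows "gram (\<lambda>x y. (\<Prod>r\<in>S. A r x y + B r x y + C r x y)
    + (\<Prod>r\<in>S. A r x y) + (\<Prod>r\<in>S. B r x y) + (\<Prod>r\<in>S. C r x y)
    - ((\<Prod>r\<in>S. A r x y + B r x y) + (\<Prod>r\<in>S. A r x y + C r x y) + (\<Prod>r\<in>S. B r x y + C r x y)))"
proof (cases "S = {}")
  \<comment> \<open>All seven empty products are 1, so the kernel is the constant 4 - 3 = 1.\<close>
  case True
  then show ?thesis using gram_const[of 1] by simp
next
  case False
  then obtain r T where S: "S = insert r T" "r \<notin> T" "finite T"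
    using assms(1) by (metis equals0I finite_insert mk_disjoint_insert)
  note diff2 = gram_prod_diff2[OF S(3)]
  note terms = gram_mult[OF assms(2)[of r] diff2[of A B C]]
    gram_mult[OF assms(3)[of r] diff2[of B A C]]
    gram_mult[OF assms(4)[of r] diff2[of C A B]]
  from gram_add[OF gram_add[OF terms(1) terms(2)] terms(3)] assms(2-4)
  show ?thesis using S by (simp add: algebra_simps)
qed

section \<open>Permanents as compressed Hadamard products\<close>

lemma fact_mult_permanent:
  fixes X :: "'a::comm_ring_1^'k^'k"
  shows "of_nat (fact CARD('k)) * permanent X
    = (\<Sum>\<pi> | \<pi> permutes UNIV. \<Sum>\<sigma> | \<sigma> permutes UNIV. \<Prod>r\<in>UNIV. X $ \<pi> r $ \<sigma> r)"
proof -
  \<comment> \<open>Reordering the factors by \<pi> replaces \<sigma> by its composite with \<pi>,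
    which again runs over all permutations. Hence every \<pi> contributes the same amount.\<close>
  have "(\<Sum>\<sigma> | \<sigma> permutes UNIV. \<Prod>r\<in>UNIV. X $ \<pi> r $ \<sigma> r) = permanent X"
    if \<pi>: "\<pi> permutes UNIV" for \<pi> :: "'k \<Rightarrow> 'k"
  proof -
    have "(\<Prod>i\<in>UNIV. X $ i $ \<sigma> i) = (\<Prod>r\<in>UNIV. X $ \<pi> r $ (\<sigma> \<circ> \<pi>) r)" for \<sigma>
      using prod.permute[OF \<pi>, of "\<lambda>i. X $ i $ \<sigma> i"] by (simp add: o_def)
    then have "permanent X
        = (\<Sum>\<sigma> | \<sigma> permutes UNIV. \<Prod>r\<in>UNIV. X $ \<pi> r $ (\<sigma> \<circ> \<pi>) r)"
      by (simp add: permanent_def)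
    also have "\<dots> = (\<Sum>\<sigma> | \<sigma> permutes UNIV. \<Prod>r\<in>UNIV. X $ \<pi> r $ \<sigma> r)"
      by (rule sum_permutations_compose_right[OF \<pi>, symmetric])
    finally show ?thesis by simp
  qed
  then have "(\<Sum>\<pi> | \<pi> permutes UNIV. \<Sum>\<sigma> | \<sigma> permutes UNIV. \<Prod>r\<in>UNIV. X $ \<pi> r $ \<sigma> r)
      = of_nat (card {\<pi>. \<pi> permutes (UNIV :: 'k set)}) * permanent X"
    by simp
  then show ?thesis
    by (simp add: card_permutations[OF refl finite])
qed

text \<open>The pullback of \<open>flatten A\<close> along the map taking (i, \<pi>) to (i, \<pi>
  r). The second component may be any function; only the later summation restricts it to
  permutations.\<close>

definition perm_kernel ::
  "('n::finite, 'm::finite) block_matrix \<Rightarrow> 'n \<Rightarrow> 'm \<times> ('n \<Rightarrow> 'n) \<Rightarrow> 'm \<times> ('n \<Rightarrow> 'n) \<Rightarrow> complex"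
  where "perm_kernel A r x y = A $ fst x $ fst y $ snd x r $ snd y r"

lemma perm_kernel_add: "perm_kernel (A + B) r x y = perm_kernel A r x y + perm_kernel B r x y"
  by (simp add: perm_kernel_def)

lemma gram_perm_kernel:
  assumes "psd (flatten A)"
  shows "gram (perm_kernel A r)"
  using gram_pullback[OF gram_if_psd[OF assms], of "\<lambda>x. (fst x, snd x r)"]
  by (simp add: flatten_def perm_kernel_def[abs_def])

lemma per\<^sub>2_nth:
  fixes A :: "('n::finite, 'm::finite) block_matrix"
  shows "per\<^sub>2 A $ i $ j = complex_of_real (1 / fact CARD('n)) *
    (\<Sum>\<pi> | \<pi> permutes UNIV. \<Sum>\<sigma> | \<sigma> permutes UNIV. \<Prod>r\<in>UNIV. perm_kernel A r (i, \<pi>) (j, \<sigma>))"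
  using fact_mult_permanent[of "A $ i $ j"]
  by (simp add: per\<^sub>2_def perm_kernel_def field_simps)

lemma hermitian_add: "hermitian X \<Longrightarrow> hermitian Y \<Longrightarrow> hermitian (X + Y)"
  unfolding hermitian_def by (metis vector_add_component complex_cnj_add)

lemma psd_add: "psd X \<Longrightarrow> psd Y \<Longrightarrow> psd (X + Y)"
  using gram_add[OF gram_if_psd gram_if_psd, of X Y] by (intro psd_if_gram) simp

lemma flatten_add: "flatten (A + B) = flatten A + flatten B"
  by (simp add: flatten_def vec_eq_iff)

text \<open>The relation \<open>loewner_le\<close> asks that each side be Hermitian, which does not
  follow from semidefiniteness of the difference.\<close>

lemma hermitian_per\<^sub>2:
  assumes "psd (flatten A)"
  shows "hermitian (per\<^sub>2 A)"
proof -
  have "gram (\<lambda>i j. per\<^sub>2 A $ i $ j)"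
    unfolding per\<^sub>2_nth
    by (intro gram_mult gram_const gram_compress
        gram_prod[OF finite gram_perm_kernel[OF assms]]) simp
  then show ?thesis using psd_if_gram psd_def by blast
qed

lemma per\<^sub>2_loewner_le:
  fixes A B C :: "('n::finite, 'm::finite) block_matrix"
  assumes "psd (flatten A)" and "psd (flatten B)" and "psd (flatten C)"
  shows "per\<^sub>2 (A + B) + per\<^sub>2 (A + C) + per\<^sub>2 (B + C)
    \<le>\<^sub>L per\<^sub>2 (A + B + C) + per\<^sub>2 A + per\<^sub>2 B + per\<^sub>2 C"
proof -
  let ?D = "per\<^sub>2 (A + B + C) + per\<^sub>2 A + per\<^sub>2 B + per\<^sub>2 C
    - (per\<^sub>2 (A + B) + per\<^sub>2 (A + C) + per\<^sub>2 (B + C))"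
  \<comment> \<open>By linearity the seven partial permanents share one compression and one factor
    \<open>1 / fact CARD('n)\<close>, so the third-order difference can be taken inside, for each
    pair of permutations.\<close>
  have "gram (\<lambda>i j. ?D $ i $ j)"
    using gram_mult[OF gram_const gram_compress[where P = "{\<pi>. \<pi> permutes UNIV}", OF gram_prod_diff3[OF finite
          gram_perm_kernel[OF assms(1)] gram_perm_kernel[OF assms(2)] gram_perm_kernel[OF assms(3)]]],
        of "1 / fact CARD('n)"]
    by (simp add: per\<^sub>2_nth perm_kernel_add sum.distrib sum_subtractf distrib_left right_diff_distrib
        del: of_real_divide)
  then have "psd ?D" by (rule psd_if_gram)
  then show ?thesis
    using assms unfolding loewner_le_def
    by (simp add: hermitian_add hermitian_per\<^sub>2 psd_add flatten_add)
qed

section \<open>Exchange of the two tensor factors\<close>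

definition swap_blocks :: "('n::finite, 'm::finite) block_matrix \<Rightarrow> ('m, 'n) block_matrix" where
  "swap_blocks A = (\<chi> r s i j. A $ i $ j $ r $ s)"

lemma swap_blocks_add: "swap_blocks (A + B) = swap_blocks A + swap_blocks B"
  by (simp add: swap_blocks_def vec_eq_iff)

lemma per\<^sub>1_eq_per\<^sub>2_swap_blocks: "per\<^sub>1 A = per\<^sub>2 (swap_blocks A)"
  by (simp add: per\<^sub>1_def per\<^sub>2_def swap_blocks_def)

text \<open>The exchange permutes rows and columns of the flattened matrix simultaneously, so it is
  a pullback along \<open>prod.swap\<close>.\<close>

lemma psd_flatten_swap_blocks:
  assumes "psd (flatten A)"
  shows "psd (flatten (swap_blocks A))"
  using gram_pullback[OF gram_if_psd[OF assms], of prod.swap]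
  by (intro psd_if_gram) (simp add: flatten_def swap_blocks_def)

theorem corollary2p5:
  fixes A B C :: "('n::finite, 'm::finite) block_matrix"
  assumes "psd (flatten A)" and "psd (flatten B)" and "psd (flatten C)"
  shows "per\<^sub>1 (A + B) + per\<^sub>1 (A + C) + per\<^sub>1 (B + C)
           \<le>\<^sub>L per\<^sub>1 (A + B + C) + per\<^sub>1 A + per\<^sub>1 B + per\<^sub>1 C
       \<and> per\<^sub>2 (A + B) + per\<^sub>2 (A + C) + per\<^sub>2 (B + C)
           \<le>\<^sub>L per\<^sub>2 (A + B + C) + per\<^sub>2 A + per\<^sub>2 B + per\<^sub>2 C"
  unfolding per\<^sub>1_eq_per\<^sub>2_swap_blocks swap_blocks_add
  using assms by (blast intro: per\<^sub>2_loewner_le psd_flatten_swap_blocks)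

end
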